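(* For every integer $k\ge 1$, there exists a triangle-free graph $G$ with chromatic number $\chi(G)>k$ such that every $C_4$-free subgraph of $G$ is $3$-colourable.
   Context: All graphs are finite and simple. Subgraphs are not necessarily induced. A graph is $C_4$-free if it contains no (not necessarily induced) subgraph isomorphic to the cycle $C_4$ on four vertices. A graph is $k$-colourable if its vertices can be assigned $k$ colours so that adjacent vertices receive different colours; $\chi(G)$ is the least $k$ such that $G$ is $k$-colourable. *)

theory Defs
  imports "Graph_Theory.Graph_Theory"
begin

text \<open>
  A finite simple graph is a \<^locale>\<open>pair_graph\<close>: a finite set of vertices with a finite,
  symmetric, irreflexive set of arcs, so that an undirected edge is the pair of arcs
  \<open>(u, v)\<close> and \<open>(v, u)\<close>. The relation \<^const>\<open>subgraph\<close> does not require induced subgraphs,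
  but it also holds for subdigraphs that are not symmetric; wherever a subgraph is meant as a
  graph in its own right, \<^const>\<open>pair_graph\<close> has to be demanded of it as well.
\<close>

text \<open>Only for \<open>n \<ge> 3\<close> is this the cycle on \<open>n\<close> vertices.\<close>

definition cycle_graph :: "nat \<Rightarrow> nat pair_pre_digraph" where
  "cycle_graph n = \<lparr> pverts = {..<n},
     parcs = {(i, j). i < n \<and> j < n \<and> (j = Suc i mod n \<or> i = Suc j mod n)} \<rparr>"

lemma pair_graph_cycle_graph:
  assumes "3 \<le> n"
  shows "pair_graph (cycle_graph n)"
proof -
  have *: "Suc i mod n \<noteq> i" if "i < n" for i
    using that assms by (cases "Suc i = n") auto
  have fin: "finite {(i, j). i < n \<and> j < n \<and> (j = Suc i mod n \<or> i = Suc j mod n)}"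
    by (rule finite_subset[of _ "{..<n} \<times> {..<n}"]) auto
  show ?thesis
    by unfold_locales (use * *[symmetric] fin in \<open>auto simp: cycle_graph_def symmetric_def sym_def\<close>)
qed

text \<open>
  If \<open>F\<close> is a graph, the subgraph \<open>K\<close> is isomorphic to \<open>F\<close> and hence a graph too.
\<close>

definition subgraph_free :: "'b pair_pre_digraph \<Rightarrow> 'a pair_pre_digraph \<Rightarrow> bool" where
  "subgraph_free F G \<longleftrightarrow>
     \<not> (\<exists>K :: 'a pair_pre_digraph.
          subgraph (with_proj K) (with_proj G) \<and> digraph_iso (with_proj F) (with_proj K))"

lemma subgraph_free_iff_no_embedding:
  assumes "pair_wf_digraph F" "pair_wf_digraph G"
  shows "subgraph_free F G \<longleftrightarrow>
    \<not> (\<exists>f. inj_on f (pverts F) \<and> f ` pverts F \<subseteq> pverts G \<and>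
           (\<forall>(u, v) \<in> parcs F. (f u, f v) \<in> parcs G))"
proof -
  interpret F: pair_wf_digraph F by fact
  interpret G: pair_wf_digraph G by fact
  have to_embedding: "\<exists>f. inj_on f (pverts F) \<and> f ` pverts F \<subseteq> pverts G \<and>
           (\<forall>(u, v) \<in> parcs F. (f u, f v) \<in> parcs G)"
    if "subgraph (with_proj K) (with_proj G)" "digraph_iso (with_proj F) (with_proj K)" for K
  proof -
    from that(2) obtain h where h: "pre_digraph.digraph_isomorphism (with_proj F) h"
      and K: "with_proj K = app_iso h (with_proj F)"
      unfolding digraph_iso_def by blast
    have ht: "iso_tail h = fst" "iso_head h = snd"
      using arg_cong[OF K, of tail] arg_cong[OF K, of head] by simp_all
    have v: "pverts K = iso_verts h ` pverts F" and a: "parcs K = iso_arcs h ` parcs F"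
      using arg_cong[OF K, of verts] arg_cong[OF K, of arcs] by simp_all
    have e: "iso_arcs h (x, y) = (iso_verts h x, iso_verts h y)" if "(x, y) \<in> parcs F" for x y
    proof -
      have "iso_verts h (fst (x, y)) = fst (iso_arcs h (x, y))"
        "iso_verts h (snd (x, y)) = snd (iso_arcs h (x, y))"
        using h that ht by (simp_all add: pre_digraph.digraph_isomorphism_def del: fst_conv snd_conv)
      then show ?thesis by (simp add: prod_eq_iff)
    qed
    have "inj_on (iso_verts h) (pverts F)"
      using h by (simp add: pre_digraph.digraph_isomorphism_def)
    moreover have "iso_verts h ` pverts F \<subseteq> pverts G" and "parcs K \<subseteq> parcs G"
      using v that(1) by (simp_all add: subgraph_def)
    moreover have "(iso_verts h x, iso_verts h y) \<in> parcs K" if "(x, y) \<in> parcs F" for x y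
      using e[OF that] a that by (metis imageI)
    ultimately show ?thesis by blast
  qed
  have of_embedding: "\<exists>K. subgraph (with_proj K) (with_proj G) \<and> digraph_iso (with_proj F) (with_proj K)"
    if f: "inj_on f (pverts F)" "f ` pverts F \<subseteq> pverts G"
      "\<forall>(u, v) \<in> parcs F. (f u, f v) \<in> parcs G" for f
  proof -
    define K where "K = \<lparr> pverts = f ` pverts F, parcs = map_prod f f ` parcs F \<rparr>"
    define h where "h = \<lparr> iso_verts = f, iso_arcs = map_prod f f, iso_head = snd, iso_tail = fst \<rparr>"
    have "inj_on (map_prod f f) (parcs F)"
      by (rule inj_on_subset[OF map_prod_inj_on[OF f(1) f(1)]])
        (auto dest: F.in_arcsD1 F.in_arcsD2)
    then have "pre_digraph.digraph_isomorphism (with_proj F) h"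
      using f(1) F.wf_digraph by (auto simp: pre_digraph.digraph_isomorphism_def h_def)
    moreover have "with_proj K = app_iso h (with_proj F)"
      by (simp add: with_proj_def app_iso_def K_def h_def)
    moreover have "wf_digraph (with_proj K)"
      by unfold_locales (auto simp: K_def dest: F.in_arcsD1 F.in_arcsD2)
    then have "subgraph (with_proj K) (with_proj G)"
      using f G.wf_digraph by (auto simp: subgraph_def compatible_def K_def)
    ultimately show ?thesis unfolding digraph_iso_def by blast
  qed
  have "(\<exists>K. subgraph (with_proj K) (with_proj G) \<and> digraph_iso (with_proj F) (with_proj K)) \<longleftrightarrow>
    (\<exists>f. inj_on f (pverts F) \<and> f ` pverts F \<subseteq> pverts G \<and>
      (\<forall>(u, v) \<in> parcs F. (f u, f v) \<in> parcs G))"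
    by (intro iffI; elim exE conjE) (rule to_embedding of_embedding; assumption)+
  then show ?thesis
    unfolding subgraph_free_def by (rule arg_cong[of _ _ Not])
qed

definition triangle_free :: "'a pair_pre_digraph \<Rightarrow> bool" where
  "triangle_free G \<longleftrightarrow> subgraph_free (cycle_graph 3) G"

definition C4_free :: "'a pair_pre_digraph \<Rightarrow> bool" where
  "C4_free G \<longleftrightarrow> subgraph_free (cycle_graph 4) G"

definition colourable :: "nat \<Rightarrow> 'a pair_pre_digraph \<Rightarrow> bool" where
  "colourable k G \<longleftrightarrow>
     (\<exists>c :: 'a \<Rightarrow> nat. (\<forall>v \<in> pverts G. c v < k) \<and> (\<forall>(u, v) \<in> parcs G. c u \<noteq> c v))"

definition chromatic_number :: "'a pair_pre_digraph \<Rightarrow> nat" where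
  "chromatic_number G = (LEAST k. colourable k G)"

lemma colourable_mono: "colourable k G \<Longrightarrow> k \<le> l \<Longrightarrow> colourable l G"
  unfolding colourable_def by (meson order_less_le_trans)

lemma (in pair_graph) colourable_card: "colourable (card (pverts G)) G"
proof -
  obtain f :: "'a \<Rightarrow> nat" where f: "bij_betw f (pverts G) {0..<card (pverts G)}"
    using ex_bij_betw_finite_nat[OF pair_finite_verts] by blast
  have "f u \<noteq> f v" if "(u, v) \<in> parcs G" for u v
    using that f pair_no_loops[OF that] in_arcsD1[OF that] in_arcsD2[OF that]
    by (auto simp: bij_betw_def dest: inj_onD)
  moreover have "f v < card (pverts G)" if "v \<in> pverts G" for v
    using that f by (auto simp: bij_betw_def)
  ultimately show ?thesis
    unfolding colourable_def by (intro exI[of _ f]) auto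
qed

text \<open>In particular, the minimum in \<^const>\<open>chromatic_number\<close> is attained for finite simple graphs.\<close>

lemma (in pair_graph) chromatic_number_gt_iff: "k < chromatic_number G \<longleftrightarrow> \<not> colourable k G"
  unfolding chromatic_number_def
  by (metis LeastI Least_le colourable_card colourable_mono not_le)

end

theory Submission
  imports Defs "HOL-Library.Ramsey" "HOL-Library.Sublist" "HOL-Combinatorics.Transposition"
begin

text \<open>
  The graph is built in layers over a finite graph \<open>F\<close> of types. Every vertex has a type, and adjacent
  vertices have adjacent types, so triangle-freeness is inherited from \<open>F\<close>. Layer \<open>0\<close> has one isolated
  vertex of each type. Layer \<open>s + 1\<close> contains, for every type \<open>\<theta>\<close>, a tree of copies of layer \<open>s\<close>: below
  each vertex of type \<open>\<theta>\<close> of a copy hangs a further copy, to depth \<open>k\<close>. A branch thus selects \<open>k\<close>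
  vertices of type \<open>\<theta>\<close>, and at its end there is, for every type \<open>\<psi>\<close> adjacent to \<open>\<theta>\<close>, an apex of
  type \<open>\<psi>\<close> joined to all of them.

  With only \<open>k\<close> colours, the total number of colours shown on the single types would grow
  with every layer (\<open>palette_sum\<close>), provided that \<open>F\<close> has no proper colouring by subsets
  of \<open>{..<k}\<close>: two adjacent types showing the same colours are contradicted by the apex of a
  branch that collects all these colours. So some layer is not \<open>k\<close>-colourable.

  A C4-free subgraph is 3-coloured copy by copy, from the root of each tree to its leaves. The apexes
  are joined to selected vertices only, and only an apex with two neighbours on the branch so
  far can be a threat to what follows. Two vertices have at most one common apex, so only boundedly
  many apexes threaten at any node, and it suffices to give one common colour to boundedly many
  vertices of type \<open>\<theta>\<close> in the next copy (\<open>tree_colouring\<close>). That this can be arranged is itself proved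
  by induction on the layers (\<open>prescribable\<close>). There the prescribed vertices can have several types,
  never more than a fixed number \<open>n\<close> of them at a time, and the types come and go while the induction descends. So the
  prescribed colours are chosen by a strategy for 3-colouring \<open>F\<close> in a pebble game with \<open>n + 1\<close>
  pebbles.

  Thus \<open>F\<close> has to be triangle-free and of large chromatic number, but 3-colourable
  for such a bounded observer. The shift graph on the \<open>r\<close>-subsets of a large set of points has these properties:
  its chromatic number is large by Ramsey's theorem, and the observer sees at most
  \<open>(n + 1) * r\<close> points at a time. If these points are labelled injectively from a supply whose size is
  quadratic in \<open>r\<close>, then the labels of its own entries determine a proper 3-colour of
  each subset (\<open>list_colour_shift\<close>, \<open>pebble_layers_shift\<close>).
\<close>

section \<open>Local three-colouring of label sequences\<close>

text \<open>
  Once a sequence without equal neighbours and with bounded values is cut at its local maxima,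
  the pieces can be two-coloured by the parity of the distance to the next local maximum, and the
  maxima themselves, no two of which are adjacent, take the third colour. The colour of a position
  depends only on a window ahead of it, whose length is linear in the bound on the values.
\<close>

definition peak :: "(nat \<Rightarrow> nat) \<Rightarrow> nat \<Rightarrow> bool" where
  "peak c d \<longleftrightarrow> c d < c (d + 1) \<and> c (d + 2) < c (d + 1)"

definition peak_colour :: "(nat \<Rightarrow> nat) \<Rightarrow> nat" where
  "peak_colour c = (let d = (LEAST d. peak c d) in if d = 0 then 2 else d mod 2)"

lemma peak_colour_less: "peak_colour c < 3"
  by (auto simp: peak_colour_def Let_def less_Suc_eq numeral_3_eq_3)

text \<open>
  A sequence below \<open>b\<close> can neither fall nor rise for \<open>b\<close> steps in a row, so within \<open>b\<close> steps it
  rises, and within \<open>b\<close> further steps it stops rising.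
\<close>

lemma peak_exists:
  assumes bound: "\<And>i. i \<le> 2 * b + 2 \<Longrightarrow> c i < b"
    and step: "\<And>i. i \<le> 2 * b + 1 \<Longrightarrow> c i \<noteq> c (Suc i)"
  shows "\<exists>d \<le> 2 * b. peak c d"
proof (rule ccontr)
  assume no: "\<not> ?thesis"
  have "\<exists>i \<le> b. c i < c (Suc i)"
  proof (rule ccontr)
    assume desc: "\<not> ?thesis"
    have "c j + j \<le> c 0" if "j \<le> Suc b" for j
      using that
    proof (induction j)
      case (Suc j)
      then have "c (Suc j) < c j"
        using desc step[of j] by (metis Suc_le_mono le_trans linorder_neqE_nat not_less_eq_eq
            le_add1 mult_2 trans_le_add1)
      with Suc show ?case by simp
    qed simp
    from this[of b] bound[of 0] show False by simp
  qed
  then obtain i where i: "i \<le> b" "c i < c (Suc i)" by blast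
  have "c (i + j) < c (Suc (i + j)) \<and> c i + j \<le> c (i + j)" if "j \<le> b" for j
    using that
  proof (induction j)
    case 0
    then show ?case using i by simp
  next
    case (Suc j)
    then have "c (i + j) < c (Suc (i + j))" "c i + j \<le> c (i + j)" by auto
    moreover have "\<not> peak c (i + j)" using no Suc.prems i(1) by auto
    moreover have "c (Suc (i + j)) \<noteq> c (Suc (Suc (i + j)))"
      using step Suc.prems i(1) by auto
    ultimately show ?case by (auto simp: peak_def)
  qed
  from this[of b] bound[of "i + b"] i(1) show False by auto
qed

lemma peak_colour_shift:
  assumes "\<exists>d. peak c d" "\<exists>d. peak (\<lambda>i. c (Suc i)) d"
  shows "peak_colour c \<noteq> peak_colour (\<lambda>i. c (Suc i))"
proof (cases "peak c 0")
  case True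
  then have "\<not> peak (\<lambda>i. c (Suc i)) 0" by (auto simp: peak_def)
  then have "(LEAST d. peak (\<lambda>i. c (Suc i)) d) \<noteq> 0"
    using assms(2) by (metis (mono_tags, lifting) LeastI_ex)
  moreover have "(LEAST d. peak c d) = 0" using True by (simp add: Least_eq_0)
  ultimately show ?thesis by (simp add: peak_colour_def Let_def)
next
  case False
  have "(LEAST d. peak c d) = Suc (LEAST d. peak c (Suc d))"
    using assms(1) False by (auto intro: Least_Suc)
  moreover have "peak c (Suc d) = peak (\<lambda>i. c (Suc i)) d" for d
    by (simp add: peak_def)
  ultimately have "(LEAST d. peak c d) = Suc (LEAST d. peak (\<lambda>i. c (Suc i)) d)"
    by simp
  then show ?thesis
    by (simp add: peak_colour_def Let_def) presburger
qed

lemma peak_colour_cong: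
  assumes "\<And>i. i \<le> m + 2 \<Longrightarrow> c i = c' i" "\<exists>d \<le> m. peak c d"
  shows "peak_colour c = peak_colour c'"
proof -
  have eq: "peak c d = peak c' d" if "d \<le> m" for d
    using that assms(1) by (simp add: peak_def)
  have "(LEAST d. peak c d) = (LEAST d. peak c' d)"
  proof (rule Least_equality[symmetric])
    obtain d where d: "d \<le> m" "peak c d" using assms(2) by blast
    then have le: "(LEAST d. peak c d) \<le> m" by (meson Least_le le_trans)
    show "peak c' (LEAST d. peak c d)" using eq[OF le] d LeastI by metis
    show "(LEAST d. peak c d) \<le> y" if "peak c' y" for y
      using that eq[of y] le by (metis Least_le le_trans nle_le)
  qed
  then show ?thesis by (simp add: peak_colour_def)
qed

text \<open>
  A colour of the ordered pair \<open>(a, b)\<close> that lies in the code \<open>{fst a, q + snd a}\<close> of \<open>a\<close> but not in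
  the code of \<open>b\<close>. It brings the number of values down from the \<open>q\<^sup>2\<close> labels to \<open>2 * q\<close>. The windows of
  \<^const>\<open>peak_colour\<close> are linear in the number of values, so after this step windows of length
  \<open>O(q)\<close> suffice, although a window may have to be drawn from a supply of labels that exceeds its
  length by any prescribed factor.
\<close>

definition arc_code :: "nat \<Rightarrow> nat \<times> nat \<Rightarrow> nat \<times> nat \<Rightarrow> nat" where
  "arc_code q a b = (if fst a \<noteq> fst b then fst a else q + snd a)"

lemma arc_code_neq:
  assumes "a \<noteq> b" "b \<in> {..<q} \<times> {..<q}" "a \<in> {..<q} \<times> {..<q}"
  shows "arc_code q a b \<noteq> arc_code q b c"
  using assms by (auto simp: arc_code_def)

definition list_colour :: "nat \<Rightarrow> (nat \<times> nat) list \<Rightarrow> nat" where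
  "list_colour q xs = peak_colour (\<lambda>i. arc_code q (xs ! i) (xs ! Suc i))"

lemma list_colour_less: "list_colour q xs < 3"
  by (simp add: list_colour_def peak_colour_less)

lemma list_colour_shift:
  assumes "distinct zs" "set zs \<subseteq> {..<q} \<times> {..<q}" "length zs = Suc (4 * q + 4)"
  shows "list_colour q (butlast zs) \<noteq> list_colour q (tl zs)"
proof -
  define c where "c i = arc_code q (zs ! i) (zs ! Suc i)" for i
  have mem: "zs ! i \<in> {..<q} \<times> {..<q}" if "i < length zs" for i
    using assms(2) that nth_mem by blast
  have bound: "c i < 2 * q" if "i < length zs" for i
    using mem[OF that] by (auto simp: c_def arc_code_def)
  have neq: "c i \<noteq> c (Suc i)" if "Suc i < length zs" for i
    unfolding c_def using that assms(1) mem by (intro arc_code_neq) (auto simp: nth_eq_iff_index_eq)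
  have ex1: "\<exists>d \<le> 2 * (2 * q). peak c d"
    by (rule peak_exists) (use bound neq assms(3) in auto)
  have ex2: "\<exists>d \<le> 2 * (2 * q). peak (\<lambda>i. c (Suc i)) d"
    by (rule peak_exists) (use bound neq assms(3) in auto)
  have "list_colour q (butlast zs) = peak_colour c"
    unfolding list_colour_def
    by (rule peak_colour_cong[symmetric, OF _ ex1]) (use assms(3) in \<open>auto simp: c_def nth_butlast\<close>)
  moreover have "list_colour q (tl zs) = peak_colour (\<lambda>i. c (Suc i))"
    unfolding list_colour_def
    by (rule peak_colour_cong[symmetric, OF _ ex2]) (use assms(3) in \<open>auto simp: c_def nth_tl\<close>)
  ultimately show ?thesis
    using peak_colour_shift[of c] ex1 ex2 by auto
qed

section \<open>Shift graphs\<close>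

text \<open>
  The shift graph on the \<open>r\<close>-element subsets of \<open>{..<N}\<close>, listed in increasing order.
\<close>

definition shift_types :: "nat \<Rightarrow> nat \<Rightarrow> nat list set" where
  "shift_types r N = {xs. length xs = r \<and> sorted_wrt (<) xs \<and> set xs \<subseteq> {..<N}}"

definition shift_adj :: "nat list \<Rightarrow> nat list \<Rightarrow> bool" where
  "shift_adj xs ys \<longleftrightarrow> tl xs = butlast ys \<or> tl ys = butlast xs"

lemma shift_adj_sym: "shift_adj xs ys \<longleftrightarrow> shift_adj ys xs"
  by (auto simp: shift_adj_def)

lemma finite_shift_types: "finite (shift_types r N)"
  by (rule finite_subset[OF _ finite_lists_length_eq[of "{..<N}" r]]) (auto simp: shift_types_def)

lemma shift_types_step:
  assumes "xs \<in> shift_types r N" "2 \<le> r" "tl xs = butlast ys" "ys \<in> shift_types r N"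
  shows "hd ys = xs ! 1" "hd xs < hd ys"
proof -
  obtain a b zs where xs: "xs = a # b # zs"
    using assms(1,2) by (cases xs rule: remdups_adj.cases) (auto simp: shift_types_def)
  obtain a' b' zs' where ys: "ys = a' # b' # zs'"
    using assms(4,2) by (cases ys rule: remdups_adj.cases) (auto simp: shift_types_def)
  show "hd ys = xs ! 1" "hd xs < hd ys"
    using assms xs ys by (auto simp: shift_types_def)
qed

text \<open>
  The adjacency relation is oriented by the first entry, so a triangle would contain
  some \<open>x \<rightarrow> y \<rightarrow> z\<close> with \<open>x \<rightarrow> z\<close>. Then \<open>y\<close> and \<open>z\<close> both start with the second entry of \<open>x\<close>, while \<open>z\<close>
  starts with the second entry of \<open>y\<close>.
\<close>

lemma shift_triangle_free:
  assumes "x \<in> shift_types r N" "y \<in> shift_types r N" "z \<in> shift_types r N" "2 \<le> r"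
    and "shift_adj x y" "shift_adj y z" "shift_adj x z"
  shows False
proof -
  note st = shift_types_step[OF _ assms(4)]
  show False
    using assms(5-7) unfolding shift_adj_def
    by (elim disjE) (use st[OF assms(1) _ assms(2)] st[OF assms(2) _ assms(1)]
      st[OF assms(2) _ assms(3)] st[OF assms(3) _ assms(2)]
      st[OF assms(1) _ assms(3)] st[OF assms(3) _ assms(1)] in auto)
qed

text \<open>
  By Ramsey's theorem some set of \<open>r + 1\<close> points has all its \<open>r\<close>-subsets of one colour; omitting
  its largest and its smallest point gives two adjacent vertices.
\<close>

lemma shift_types_uncolourable:
  assumes "finite C"
  shows "\<exists>N. \<forall>h. h ` shift_types r N \<subseteq> C \<longrightarrow>
    (\<exists>x \<in> shift_types r N. \<exists>y \<in> shift_types r N. shift_adj x y \<and> h x = (h y :: 'c))"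
proof -
  obtain e where e: "bij_betw e C {..<card C}"
    using assms ex_bij_betw_finite_nat atLeast0LessThan by metis
  obtain N where N: "partn_lst {..<N::nat} (replicate (card C) (Suc r)) r"
    using ramsey_full by blast
  show ?thesis
  proof (intro exI[of _ N] allI impI)
    fix h :: "nat list \<Rightarrow> 'c" assume h: "h ` shift_types r N \<subseteq> C"
    have srt: "sorted_list_of_set X \<in> shift_types r N" if "X \<in> [{..<N}]\<^bsup>r\<^esup>" for X
      using that by (auto simp: nsets_def shift_types_def)
    have "(\<lambda>X. e (h (sorted_list_of_set X))) \<in> [{..<N}]\<^bsup>r\<^esup> \<rightarrow> {..<length (replicate (card C) (Suc r))}"
    proof
      fix X assume "X \<in> [{..<N}]\<^bsup>r\<^esup>"
      then have "h (sorted_list_of_set X) \<in> C" using srt h by blast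
      then show "e (h (sorted_list_of_set X)) \<in> {..<length (replicate (card C) (Suc r))}"
        using e by (auto simp: bij_betw_def)
    qed
    with N obtain i H where i: "i < card C" and H: "H \<in> [{..<N}]\<^bsup>(Suc r)\<^esup>"
      and mono: "(\<lambda>X. e (h (sorted_list_of_set X))) ` [H]\<^bsup>r\<^esup> \<subseteq> {i}"
      unfolding partn_lst_def monochromatic_def by fastforce
    define zs where "zs = sorted_list_of_set H"
    have zs: "sorted_wrt (<) zs" "set zs = H" "length zs = Suc r" "H \<subseteq> {..<N}"
      using H by (auto simp: zs_def nsets_def)
    have key: "xs \<in> shift_types r N \<and> e (h xs) = i"
      if "sorted_wrt (<) xs" "set xs \<subseteq> H" "length xs = r" for xs
    proof -
      have "sorted_list_of_set (set xs) = xs"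
        using that(1) by (meson strict_sorted_equal strict_sorted_list_of_set
            set_sorted_list_of_set finite_set)
      moreover have "set xs \<in> [H]\<^bsup>r\<^esup>"
        using that distinct_card strict_sorted_iff by (fastforce simp: nsets_def)
      ultimately show ?thesis
        using mono that zs(4) by (force simp: shift_types_def)
    qed
    have b: "butlast zs \<in> shift_types r N \<and> e (h (butlast zs)) = i"
      using zs by (intro key) (auto simp: sorted_wrt_iff_nth_less nth_butlast dest: in_set_butlastD)
    have t: "tl zs \<in> shift_types r N \<and> e (h (tl zs)) = i"
      using zs by (intro key) (auto simp: sorted_wrt_iff_nth_less nth_tl dest: list.set_sel(2) intro: list.set_sel(2))
    have "h (butlast zs) = h (tl zs)"
      using b t h e by (metis (no_types, lifting) bij_betw_imp_inj_on image_subset_iff inj_onD)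
    then show "\<exists>x \<in> shift_types r N. \<exists>y \<in> shift_types r N. shift_adj x y \<and> h x = h y"
      using b t by (intro bexI[of _ "butlast zs"] bexI[of _ "tl zs"]) (auto simp: shift_adj_def butlast_tl)
  qed
qed

section \<open>The layered construction\<close>

text \<open>
  \<open>Copy \<theta> p v\<close> is the vertex \<open>v\<close> in the copy of the previous layer that hangs at the node \<open>p\<close> of the
  tree of type \<open>\<theta>\<close>; the sequence \<open>p\<close> records which vertex was chosen in each of the copies above it.
  \<open>Apex \<theta> p \<psi>\<close> is a vertex of type \<open>\<psi>\<close> below the full branch \<open>p\<close>, joined to all the vertices chosen
  along \<open>p\<close>.
\<close>

datatype 'f vert = Base 'f | Copy 'f "'f vert list" "'f vert" | Apex 'f "'f vert list" 'f

primrec ty :: "'f vert \<Rightarrow> 'f" where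
  "ty (Base \<phi>) = \<phi>"
| "ty (Copy \<theta> p v) = ty v"
| "ty (Apex \<theta> p \<psi>) = \<psi>"

fun adj :: "'f vert \<Rightarrow> 'f vert \<Rightarrow> bool" where
  "adj (Copy \<theta> p u) (Copy \<theta>' q v) \<longleftrightarrow> \<theta> = \<theta>' \<and> p = q \<and> adj u v"
| "adj (Apex \<theta> p \<psi>) (Copy \<theta>' q v) \<longleftrightarrow> \<theta> = \<theta>' \<and> (\<exists>i < length p. q = take i p \<and> v = p ! i)"
| "adj (Copy \<theta>' q v) (Apex \<theta> p \<psi>) \<longleftrightarrow> \<theta> = \<theta>' \<and> (\<exists>i < length p. q = take i p \<and> v = p ! i)"
| "adj _ _ \<longleftrightarrow> False"

lemma adj_sym: "adj u v \<longleftrightarrow> adj v u"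
  by (induction u v rule: adj.induct) auto

definition of_type :: "'f vert set \<Rightarrow> 'f \<Rightarrow> 'f vert set" where
  "of_type V \<theta> = {v \<in> V. ty v = \<theta>}"

locale typed_layers =
  fixes F :: "'f set" and R :: "'f \<Rightarrow> 'f \<Rightarrow> bool" and k :: nat
  assumes finite_F: "finite F" and R_sym: "R \<phi> \<psi> \<longleftrightarrow> R \<psi> \<phi>"
begin

primrec layer :: "nat \<Rightarrow> 'f vert set" where
  "layer 0 = Base ` F"
| "layer (Suc s) =
    {Copy \<theta> p v | \<theta> p v. \<theta> \<in> F \<and> set p \<subseteq> of_type (layer s) \<theta> \<and> length p < k \<and> v \<in> layer s} \<union>
    {Apex \<theta> p \<psi> | \<theta> p \<psi>. \<theta> \<in> F \<and> set p \<subseteq> of_type (layer s) \<theta> \<and> length p = k \<and> \<psi> \<in> F \<and> R \<theta> \<psi>}"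

lemma finite_layer: "finite (layer s)"
proof (induction s)
  case 0
  then show ?case by (simp add: finite_F)
next
  case (Suc s)
  let ?L = "{p. set p \<subseteq> layer s \<and> length p \<le> k}"
  have L: "finite ?L" using Suc by (rule finite_lists_length_le)
  have "layer (Suc s) \<subseteq> (\<lambda>(\<theta>, p, v). Copy \<theta> p v) ` (F \<times> ?L \<times> layer s)
      \<union> (\<lambda>(\<theta>, p, \<psi>). Apex \<theta> p \<psi>) ` (F \<times> ?L \<times> F)"
    by (auto simp: of_type_def image_iff)
  then show ?case
    by (rule finite_subset) (use L Suc finite_F in auto)
qed

lemma ty_layer: "v \<in> layer s \<Longrightarrow> ty v \<in> F"
  by (induction s arbitrary: v) auto

text \<open>
  The type is a homomorphism to the graph of types. This is how the layers inherit
  triangle-freeness.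
\<close>

lemma adj_types: "u \<in> layer s \<Longrightarrow> v \<in> layer s \<Longrightarrow> adj u v \<Longrightarrow> R (ty u) (ty v)"
proof (induction s arbitrary: u v)
  case (Suc s)
  have ap: "R \<psi> (ty (p ! i))" if "R \<theta> \<psi>" "set p \<subseteq> of_type V \<theta>" "i < length p"
    for \<theta> \<psi> p i V
    using that subsetD[OF that(2) nth_mem[OF that(3)]] R_sym[of \<theta> \<psi>] by (simp add: of_type_def)
  have ap': "R (ty (p ! i)) \<psi>" if "R \<theta> \<psi>" "set p \<subseteq> of_type V \<theta>" "i < length p"
    for \<theta> \<psi> p i V
    using ap[OF that] R_sym by blast
  from Suc.prems show ?case
    by (auto intro: Suc.IH) (erule (2) ap ap')+
qed auto

subsection \<open>Chromatic number\<close>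

definition palette :: "('f vert \<Rightarrow> nat) \<Rightarrow> nat \<Rightarrow> 'f \<Rightarrow> nat set" where
  "palette c s \<phi> = c ` of_type (layer s) \<phi>"

text \<open>
  Each copy of the previous layer shows at most the colours of the whole layer, type by type. If
  the total number of colours did not grow, every copy would show on every type exactly the same
  colours as the whole layer. As there are fewer subsets of \<open>{..<k}\<close> than the type graph needs
  colours, two adjacent types \<open>\<theta>\<close> and \<open>\<psi>\<close> show the same set \<open>U\<close>. Since every copy offers all of \<open>U\<close> on
  type \<open>\<theta>\<close>, some branch of the tree of type \<open>\<theta>\<close> collects all of \<open>U\<close>, and its apex of type \<open>\<psi>\<close> has a
  colour that is not in \<open>U\<close>.
\<close>

lemma palette_sum:
  assumes k: "k \<ge> 1"
    and uncol: "\<And>h. h ` F \<subseteq> Pow {..<k} \<Longrightarrow> \<exists>\<phi> \<in> F. \<exists>\<psi> \<in> F. R \<phi> \<psi> \<and> h \<phi> = h \<psi>"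
    and c: "\<And>v. v \<in> layer s \<Longrightarrow> c v < k"
      "\<And>u v. u \<in> layer s \<Longrightarrow> v \<in> layer s \<Longrightarrow> adj u v \<Longrightarrow> c u \<noteq> c v"
  shows "(\<forall>\<phi> \<in> F. palette c s \<phi> \<noteq> {}) \<and> s \<le> (\<Sum>\<phi>\<in>F. card (palette c s \<phi>))"
  using c
proof (induction s arbitrary: c)
  case 0
  then show ?case by (auto simp: palette_def of_type_def)
next
  case (Suc s)
  define cc where "cc \<theta> p v = c (Copy \<theta> p v)" for \<theta> p v
  have IH: "(\<forall>\<phi> \<in> F. palette (cc \<theta> p) s \<phi> \<noteq> {}) \<and> s \<le> (\<Sum>\<phi>\<in>F. card (palette (cc \<theta> p) s \<phi>))"
    if "\<theta> \<in> F" "set p \<subseteq> of_type (layer s) \<theta>" "length p < k" for \<theta> p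
    by (rule Suc.IH; unfold cc_def, rule Suc.prems) (use that in auto)
  have sub: "palette (cc \<theta> p) s \<phi> \<subseteq> palette c (Suc s) \<phi>"
    if "\<theta> \<in> F" "set p \<subseteq> of_type (layer s) \<theta>" "length p < k" for \<theta> p \<phi>
    using that by (force simp: palette_def of_type_def cc_def)
  have fin: "finite (palette c (Suc s) \<phi>)" for \<phi>
    unfolding palette_def of_type_def using finite_layer[of "Suc s"] by (intro finite_imageI) simp
  have ne: "\<forall>\<phi> \<in> F. palette c (Suc s) \<phi> \<noteq> {}"
  proof
    fix \<phi> assume "\<phi> \<in> F"
    then show "palette c (Suc s) \<phi> \<noteq> {}"
      using IH[of \<phi> "[]"] sub[of \<phi> "[]" \<phi>] k by force
  qed
  have "Suc s \<le> (\<Sum>\<phi>\<in>F. card (palette c (Suc s) \<phi>))"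
  proof (rule ccontr)
    assume "\<not> ?thesis"
    then have small: "(\<Sum>\<phi>\<in>F. card (palette c (Suc s) \<phi>)) \<le> s" by simp
    have all: "palette (cc \<theta> p) s \<phi> = palette c (Suc s) \<phi>"
      if "\<theta> \<in> F" "set p \<subseteq> of_type (layer s) \<theta>" "length p < k" "\<phi> \<in> F" for \<theta> p \<phi>
    proof (rule ccontr)
      assume "\<not> ?thesis"
      then have "palette (cc \<theta> p) s \<phi> \<subset> palette c (Suc s) \<phi>" using sub[OF that(1-3)] by blast
      then have "card (palette (cc \<theta> p) s \<phi>) < card (palette c (Suc s) \<phi>)"
        by (rule psubset_card_mono[OF fin])
      then have "(\<Sum>\<phi>\<in>F. card (palette (cc \<theta> p) s \<phi>)) < (\<Sum>\<phi>\<in>F. card (palette c (Suc s) \<phi>))"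
        using sub[OF that(1-3)] that(4) finite_F
        by (intro sum_strict_mono_ex1) (auto intro: card_mono[OF fin])
      with IH[OF that(1-3)] small show False by simp
    qed
    have "palette c (Suc s) ` F \<subseteq> Pow {..<k}"
      using Suc.prems(1) by (auto simp: palette_def of_type_def)
    then obtain \<theta> \<psi> where e: "\<theta> \<in> F" "\<psi> \<in> F" "R \<theta> \<psi>"
      and eq: "palette c (Suc s) \<theta> = palette c (Suc s) \<psi>"
      using uncol by blast
    define U where "U = palette c (Suc s) \<theta>"
    have U: "U \<subseteq> {..<k}" "U \<noteq> {}"
      using Suc.prems(1) ne e(1) by (auto simp: U_def palette_def of_type_def)
    then obtain u0 where u0: "u0 \<in> U" by blast
    \<comment> \<open>A branch has exactly \<open>k\<close> vertices, so the enumeration of \<open>U\<close> is padded by \<open>u0\<close>.\<close>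
    define u where "u i = (if i \<in> U then i else u0)" for i
    have uU: "u i \<in> U" for i using u0 by (simp add: u_def)
    have "\<exists>p. set p \<subseteq> of_type (layer s) \<theta> \<and> length p = n \<and>
        (\<forall>i < n. c (Copy \<theta> (take i p) (p ! i)) = u i)" if "n \<le> k" for n
      using that
    proof (induction n)
      case (Suc n)
      then obtain p where p: "set p \<subseteq> of_type (layer s) \<theta>" "length p = n"
        "\<forall>i < n. c (Copy \<theta> (take i p) (p ! i)) = u i" by auto
      have "u n \<in> palette (cc \<theta> p) s \<theta>"
        using all[OF e(1) p(1) _ e(1)] p(2) Suc.prems uU by (auto simp: U_def)
      then obtain x where "x \<in> of_type (layer s) \<theta>" "c (Copy \<theta> p x) = u n"
        by (auto simp: palette_def cc_def)
      then show ?case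
        using p by (intro exI[of _ "p @ [x]"]) (auto simp: nth_append less_Suc_eq)
    qed simp
    then obtain p where p: "set p \<subseteq> of_type (layer s) \<theta>" "length p = k"
      "\<forall>i < k. c (Copy \<theta> (take i p) (p ! i)) = u i" by blast
    let ?y = "Apex \<theta> p \<psi>"
    have y: "?y \<in> layer (Suc s)" using p e by auto
    have "c ?y \<in> U" unfolding U_def eq using y by (auto simp: palette_def of_type_def)
    moreover from this have "c ?y < k" using U by auto
    moreover have "Copy \<theta> (take i p) (p ! i) \<in> layer (Suc s)" if "i < k" for i
      using that p(2) e(1) subsetD[OF p(1) nth_mem[of i p]] order_trans[OF set_take_subset[of i p] p(1)]
      by (auto simp: of_type_def[of _ \<theta>])
    then have "c ?y \<noteq> u i" if "i < k" for i
      using Suc.prems(2)[OF y, of "Copy \<theta> (take i p) (p ! i)"] p that by auto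
    ultimately show False by (metis u_def)
  qed
  with ne show ?case by blast
qed

end

section \<open>Colouring the copies of a tree from the top down\<close>

text \<open>
  Dependent choice along the nodes of a tree: a copy is coloured by \<open>f\<close> with knowledge only of the
  colours \<open>cs\<close> of the vertices chosen on the way to it, which is all that the invariant speaks of.
\<close>

lemma path_choice:
  assumes start: "Inv [] []"
    and step: "\<And>p cs. set p \<subseteq> A \<Longrightarrow> length p < k \<Longrightarrow> length cs = length p \<Longrightarrow> Inv p cs \<Longrightarrow>
      \<exists>f. Q p f \<and> (\<forall>x \<in> A. Inv (p @ [x]) (cs @ [f x]))"
  obtains col where
    "\<And>p. set p \<subseteq> A \<Longrightarrow> length p < k \<Longrightarrow> Q p (col p)"
    "\<And>p. set p \<subseteq> A \<Longrightarrow> length p \<le> k \<Longrightarrow> Inv p (map (\<lambda>i. col (take i p) (p ! i)) [0..<length p])"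
proof -
  define F where
    "F p cs = (SOME f. Q p f \<and> (\<forall>x \<in> A. Inv (p @ [x]) (cs @ [f x])))" for p cs
  have F: "Q p (F p cs) \<and> (\<forall>x \<in> A. Inv (p @ [x]) (cs @ [F p cs x]))"
    if "set p \<subseteq> A" "length p < k" "length cs = length p" "Inv p cs" for p cs
    unfolding F_def using someI_ex[OF step[OF that]] .
  define cols where "cols p = snd (foldl (\<lambda>(q, cs) x. (q @ [x], cs @ [F q cs x])) ([], []) p)" for p
  have fst: "fst (foldl (\<lambda>(q, cs) x. (q @ [x], cs @ [F q cs x])) ([], []) p) = p" for p
    by (induction p rule: rev_induct) (auto simp: case_prod_unfold)
  have cols_snoc: "cols (p @ [x]) = cols p @ [F p (cols p) x]" for p x
    using fst[of p] by (simp add: cols_def case_prod_unfold)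
  define col where "col p = F p (cols p)" for p
  have cols: "cols p = map (\<lambda>i. col (take i p) (p ! i)) [0..<length p]" for p
  proof (induction p rule: rev_induct)
    case Nil
    then show ?case by (simp add: cols_def)
  next
    case (snoc x p)
    then show ?case
      by (auto simp: snoc cols_snoc nth_append col_def cong: map_cong)
  qed
  have inv: "Inv p (cols p)" if "set p \<subseteq> A" "length p \<le> k" for p
    using that
  proof (induction p rule: rev_induct)
    case Nil
    then show ?case using start by (simp add: cols_def)
  next
    case (snoc x p)
    then show ?case using F[of p "cols p"] by (auto simp: cols_snoc cols[of p])
  qed
  show ?thesis
  proof
    show "Q p (col p)" if "set p \<subseteq> A" "length p < k" for p
      using F[of p "cols p"] inv[of p] that unfolding col_def by (simp add: cols[of p])
    show "Inv p (map (\<lambda>i. col (take i p) (p ! i)) [0..<length p])"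
      if "set p \<subseteq> A" "length p \<le> k" for p
      using inv[OF that] by (simp add: cols)
  qed
qed

section \<open>Three-colouring C4-free subgraphs\<close>

definition no_C4 :: "('v \<Rightarrow> 'v \<Rightarrow> bool) \<Rightarrow> bool" where
  "no_C4 E \<longleftrightarrow> (\<forall>a b u v. u \<noteq> v \<longrightarrow> E a u \<longrightarrow> E a v \<longrightarrow> E b u \<longrightarrow> E b v \<longrightarrow> a = b)"

text \<open>
  The vertices that are chosen on the way to a vertex, with the vertex itself included if it lies
  in a copy, and the type of the tree in which this happens.
\<close>

primrec trace :: "'f vert \<Rightarrow> 'f vert list" where
  "trace (Base \<phi>) = []"
| "trace (Copy \<theta> p v) = p @ [v]"
| "trace (Apex \<theta> p \<psi>) = p"

primrec root :: "'f vert \<Rightarrow> 'f" where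
  "root (Base \<phi>) = \<phi>"
| "root (Copy \<theta> p v) = \<theta>"
| "root (Apex \<theta> p \<psi>) = \<theta>"

text \<open>
  The type graph itself is far from being 3-colourable. What the layers need is only that it looks
  3-colourable to somebody who sees at most \<open>n + 1\<close> types at a time: \<open>P\<close> is a winning strategy for
  Duplicator in the existential pebble game between the type graph and the triangle.
\<close>

locale pebble_layers = typed_layers F R k
  for F :: "'f set" and R :: "'f \<Rightarrow> 'f \<Rightarrow> bool" and k :: nat +
  fixes P :: "('f \<rightharpoonup> nat) set" and n :: nat
  assumes P_less: "g \<in> P \<Longrightarrow> g \<phi> = Some a \<Longrightarrow> a < 3"
    and P_proper: "g \<in> P \<Longrightarrow> R \<phi> \<psi> \<Longrightarrow> g \<phi> = Some a \<Longrightarrow> g \<psi> = Some b \<Longrightarrow> a \<noteq> b"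
    and P_empty: "Map.empty \<in> P"
    and P_restrict: "g \<in> P \<Longrightarrow> g |` A \<in> P"
    and P_extend: "g \<in> P \<Longrightarrow> finite (dom g) \<Longrightarrow> card (dom g) \<le> n \<Longrightarrow> \<theta> \<in> F \<Longrightarrow> \<theta> \<notin> dom g \<Longrightarrow>
      \<exists>c. g(\<theta> \<mapsto> c) \<in> P"
    and k_le: "k * k \<le> n"
begin

text \<open>
  The statement for induction on the layers: besides being 3-colourable, a C4-free subgraph admits
  a 3-colouring in which any \<open>n\<close> vertices have the colours that a position of the pebble game gives to
  their types. In particular up to \<open>n\<close> vertices of one common type can be forced to be
  monochromatic, which is what the colouring of the next layer consumes.
\<close>

definition prescribable :: "nat \<Rightarrow> bool" where
  "prescribable s \<longleftrightarrow> (\<forall>E S g. symp E \<and> no_C4 E \<and> (\<forall>u v. E u v \<longrightarrow> adj u v) \<and>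
     S \<subseteq> layer s \<and> finite S \<and> card S \<le> n \<and> g \<in> P \<and> ty ` S \<subseteq> dom g \<longrightarrow>
     (\<exists>f. (\<forall>v. f v < 3) \<and> (\<forall>u \<in> layer s. \<forall>v \<in> layer s. E u v \<longrightarrow> f u \<noteq> f v) \<and>
          (\<forall>v \<in> S. g (ty v) = Some (f v))))"

lemma prescribableD:
  assumes "prescribable s" "symp E" "no_C4 E" "\<forall>u v. E u v \<longrightarrow> adj u v"
    "S \<subseteq> layer s" "finite S" "card S \<le> n" "g \<in> P" "ty ` S \<subseteq> dom g"
  obtains f where "\<And>v. f v < 3" "\<And>u v. u \<in> layer s \<Longrightarrow> v \<in> layer s \<Longrightarrow> E u v \<Longrightarrow> f u \<noteq> f v"
    "\<And>v. v \<in> S \<Longrightarrow> g (ty v) = Some (f v)"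
  using assms unfolding prescribable_def by metis

lemma extend_type:
  assumes "g \<in> P" "finite (dom g)" "card (dom g) \<le> n" "\<theta> \<in> F"
  obtains h c where "h \<in> P" "h \<theta> = Some c" "\<And>\<phi>. \<phi> \<in> dom g \<Longrightarrow> h \<phi> = g \<phi>"
proof (cases "\<theta> \<in> dom g")
  case True
  then show ?thesis using that[of g] assms(1) by auto
next
  case False
  then obtain c where "g(\<theta> \<mapsto> c) \<in> P" using P_extend assms by blast
  moreover have "(g(\<theta> \<mapsto> c)) \<phi> = g \<phi>" if "\<phi> \<in> dom g" for \<phi>
    using that False by auto
  ultimately show ?thesis using that[of "g(\<theta> \<mapsto> c)" c] by simp
qed

text \<open>
  An apex sees vertices of a single branch, and it must not see three colours there. The copies
  are coloured from the top down, and for every node a colour \<open>a\<close> is maintained such that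
  every apex below the node has seen at most one colour besides \<open>a\<close>. In the next copy, call a vertex
  critical if it leads to an apex that already has two neighbours above. Critical vertices are given
  the colour \<open>a\<close>, which keeps \<open>a\<close> valid below them. Below any other vertex, every apex has at most one
  neighbour higher up, so the colour of that vertex can take over the role of \<open>a\<close>.
  In a C4-free graph two vertices determine at most one apex joined to both, so there are at most
  \<open>k\<^sup>2 \<le> n\<close> critical vertices in a copy. All of them have type \<open>\<theta>\<close>, and the previous layer can be
  coloured so that they agree.
  
  The prescription on \<open>S\<close> is met by playing one more move of the pebble game, which gives a colour \<open>\<kappa>\<close>
  to the type \<open>\<theta>\<close>: every vertex that leads to an element of \<open>S\<close> is coloured \<open>\<kappa>\<close>. In each copy this
  prescribes at most one vertex for every element of \<open>S\<close>. Along such a branch only the colour \<open>\<kappa>\<close> is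
  seen, so there is nothing critical, and an apex in \<open>S\<close> can have its prescribed colour because \<open>P\<close> only
  contains proper colourings.
\<close>

lemma tree_colouring:
  assumes IH: "prescribable s"
    and E: "symp E" "no_C4 E" "\<And>u v. E u v \<Longrightarrow> adj u v"
    and S: "S \<subseteq> layer (Suc s)" "finite S" "card S \<le> n"
    and g: "g \<in> P" "ty ` S \<subseteq> dom g" and \<theta>: "\<theta> \<in> F"
  defines "A \<equiv> of_type (layer s) \<theta>"
  obtains col where
    "\<And>p v. set p \<subseteq> A \<Longrightarrow> length p < k \<Longrightarrow> col p v < 3"
    "\<And>p u v. set p \<subseteq> A \<Longrightarrow> length p < k \<Longrightarrow> u \<in> layer s \<Longrightarrow> v \<in> layer s \<Longrightarrow>
       E (Copy \<theta> p u) (Copy \<theta> p v) \<Longrightarrow> col p u \<noteq> col p v"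
    "\<And>p v. set p \<subseteq> A \<Longrightarrow> length p < k \<Longrightarrow> Copy \<theta> p v \<in> S \<Longrightarrow> g (ty v) = Some (col p v)"
    "\<And>p \<psi>. set p \<subseteq> A \<Longrightarrow> length p = k \<Longrightarrow> R \<theta> \<psi> \<Longrightarrow>
       \<exists>c < 3. (\<forall>i < k. E (Apex \<theta> p \<psi>) (Copy \<theta> (take i p) (p ! i)) \<longrightarrow> col (take i p) (p ! i) \<noteq> c) \<and>
         (Apex \<theta> p \<psi> \<in> S \<longrightarrow> g \<psi> = Some c)"
proof -
  have A: "A \<subseteq> layer s" "\<And>v. v \<in> A \<Longrightarrow> ty v = \<theta>" by (auto simp: A_def of_type_def)
  have dom0: "dom (g |` (ty ` S)) = ty ` S" using g(2) by auto
  have "card (ty ` S) \<le> n" using card_image_le[OF S(2), of ty] S(3) by simp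
  then obtain h \<kappa> where h: "h \<in> P" "h \<theta> = Some \<kappa>" "\<And>\<phi>. \<phi> \<in> ty ` S \<Longrightarrow> h \<phi> = g \<phi>"
    using extend_type[OF P_restrict[OF g(1), of "ty ` S"] _ _ \<theta>] dom0 S(2)
    by (metis finite_imageI restrict_in)
  have \<kappa>: "\<kappa> < 3" using P_less h by blast

  \<comment> \<open>A node is alert if it leads to an element of \<open>S\<close>, and the marked vertices of the copy at \<open>p\<close> are
    those that continue towards \<open>S\<close> or belong to it.\<close>
  define alert where "alert q \<longleftrightarrow> (\<exists>x \<in> S. root x = \<theta> \<and> prefix q (trace x))" for q
  define marked where "marked p = {x. alert (p @ [x])}" for p
  have alert_prefix: "alert p" if "alert (p @ [x])" for p x
    using that append_prefixD unfolding alert_def by blast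
  have marked_sub: "marked p \<subseteq> (\<lambda>x. trace x ! length p) ` S" for p
    unfolding marked_def alert_def prefix_def by (force simp: nth_append)
  have marked_finite: "finite (marked p)" "card (marked p) \<le> n" for p
    using marked_sub[of p] S(2,3) surj_card_le[OF S(2) marked_sub[of p]]
    by (auto intro: finite_subset)
  have trace_mem: "v \<in> layer s \<and> (ty v = \<theta> \<or> ty v \<in> ty ` S)" if "x \<in> S" "root x = \<theta>" "v \<in> set (trace x)" for x v
  proof -
    have "x \<in> layer (Suc s)" using that(1) S(1) by blast
    then have "(\<exists>p w. x = Copy \<theta> p w \<and> set p \<subseteq> A \<and> w \<in> layer s) \<or>
        (\<exists>p \<psi>. x = Apex \<theta> p \<psi> \<and> set p \<subseteq> A)"
      using that(2) unfolding A_def by auto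
    then consider p w where "x = Copy \<theta> p w" "set p \<subseteq> A" "w \<in> layer s"
      | p \<psi> where "x = Apex \<theta> p \<psi>" "set p \<subseteq> A" by blast
    then show ?thesis
    proof cases
      case 1
      then have "ty w \<in> ty ` S" using imageI[OF that(1), of ty] by simp
      then show ?thesis using 1 that(3) A by auto
    qed (use that(3) A in auto)
  qed
  have marked_layer: "x \<in> layer s" and marked_ty: "ty x = \<theta> \<or> ty x \<in> ty ` S" if x: "x \<in> marked p" for x p
  proof -
    from x obtain y where y: "y \<in> S" "root y = \<theta>" "prefix (p @ [x]) (trace y)"
      by (auto simp: marked_def alert_def)
    then have "x \<in> set (trace y)" by (auto simp: prefix_def)
    then show "x \<in> layer s" "ty x = \<theta> \<or> ty x \<in> ty ` S" using trace_mem y by blast+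
  qed

  define sees where "sees r \<psi> p i \<longleftrightarrow> E (Apex \<theta> r \<psi>) (Copy \<theta> (take i p) (p ! i))" for r \<psi> p i
  define Inv where "Inv p cs \<longleftrightarrow> (alert p \<longrightarrow> (\<forall>i < length p. cs ! i = \<kappa>)) \<and>
      (\<exists>a < 3. \<forall>r \<psi>. prefix p r \<longrightarrow> (\<exists>b. \<forall>i < length p. sees r \<psi> p i \<longrightarrow> cs ! i \<in> {a, b}))"
    for p cs
  define Q where "Q p f \<longleftrightarrow> (\<forall>v. f v < 3) \<and>
      (\<forall>u \<in> layer s. \<forall>v \<in> layer s. E (Copy \<theta> p u) (Copy \<theta> p v) \<longrightarrow> f u \<noteq> f v) \<and>
      (\<forall>v \<in> marked p. h (ty v) = Some (f v))" for p and f :: "'f vert \<Rightarrow> nat"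
  have sees_snoc: "sees r \<psi> (p @ [x]) i \<longleftrightarrow> sees r \<psi> p i" if "i < length p" for r \<psi> p x i
    using that by (simp add: sees_def nth_append)

  have step: "\<exists>f. Q p f \<and> (\<forall>x \<in> A. Inv (p @ [x]) (cs @ [f x]))"
    if p: "set p \<subseteq> A" "length p < k" "length cs = length p" and inv: "Inv p cs" for p cs
  proof -
    define Ep where "Ep u v \<longleftrightarrow> E (Copy \<theta> p u) (Copy \<theta> p v)" for u v
    have Ep_symp: "symp Ep" using E(1) unfolding symp_def Ep_def by blast
    have Ep_no_C4: "no_C4 Ep"
      using E(2) unfolding no_C4_def Ep_def by (metis vert.inject(2))
    have Ep_adj: "\<forall>u v. Ep u v \<longrightarrow> adj u v"
      using E(3) unfolding Ep_def by fastforce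
    note presc = prescribableD[OF IH Ep_symp Ep_no_C4 Ep_adj]
    show ?thesis
    proof (cases "alert p")
      case True
      have dh: "ty ` marked p \<subseteq> dom h"
        using marked_ty h(2,3) g(2) by fastforce
      obtain f where f: "\<And>v. f v < 3" "\<And>u v. u \<in> layer s \<Longrightarrow> v \<in> layer s \<Longrightarrow> Ep u v \<Longrightarrow> f u \<noteq> f v"
        "\<And>v. v \<in> marked p \<Longrightarrow> h (ty v) = Some (f v)"
        using presc[OF _ marked_finite h(1) dh] marked_layer by (metis subsetI)
      have "Inv (p @ [x]) (cs @ [f x])" if x: "x \<in> A" for x
        unfolding Inv_def
      proof (intro conjI impI)
        have cs: "\<forall>i < length p. cs ! i = \<kappa>" using inv True by (auto simp: Inv_def)
        show "\<forall>i < length (p @ [x]). (cs @ [f x]) ! i = \<kappa>" if "alert (p @ [x])"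
        proof -
          have "f x = \<kappa>" using f(3)[of x] that A(2)[OF x] h(2) by (simp add: marked_def)
          then show ?thesis using cs p(3) by (auto simp: nth_append less_Suc_eq)
        qed
        show "\<exists>a < 3. \<forall>r \<psi>. prefix (p @ [x]) r \<longrightarrow>
            (\<exists>b. \<forall>i < length (p @ [x]). sees r \<psi> (p @ [x]) i \<longrightarrow> (cs @ [f x]) ! i \<in> {a, b})"
          using cs p(3) f(1)
          by (intro exI[of _ "f x"] conjI allI impI exI[of _ \<kappa>]) (auto simp: nth_append less_Suc_eq)
      qed
      then show ?thesis using f by (intro exI[of _ f]) (auto simp: Q_def Ep_def)
    next
      case False
      then have no_marked: "marked p = {}" using alert_prefix by (auto simp: marked_def)
      obtain a where a: "a < 3"
        "\<And>r \<psi>. prefix p r \<Longrightarrow> \<exists>b. \<forall>i < length p. sees r \<psi> p i \<longrightarrow> cs ! i \<in> {a, b}"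
        using inv by (auto simp: Inv_def)
      define two where "two r i j \<longleftrightarrow> (\<exists>\<psi>. i < j \<and> j < length p \<and> sees r \<psi> p i \<and> sees r \<psi> p j)" for r i j
      define critical where "critical = {x \<in> A. \<exists>r i j. prefix (p @ [x]) r \<and> two r i j}"
      have uniq: "r = r'" if "two r i j" "two r' i j" for r r' i j
      proof -
        have ne: "Copy \<theta> (take i p) (p ! i) \<noteq> Copy \<theta> (take j p) (p ! j)"
          using that(1) by (auto simp: two_def dest: arg_cong[of _ _ length])
        from that obtain \<psi> \<psi>' where "sees r \<psi> p i" "sees r \<psi> p j" "sees r' \<psi>' p i" "sees r' \<psi>' p j"
          by (auto simp: two_def)
        then have "Apex \<theta> r \<psi> = Apex \<theta> r' \<psi>'"
          using E(2) ne unfolding sees_def no_C4_def by blast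
        then show ?thesis by simp
      qed
      define w where "w = (\<lambda>(i, j). (SOME r. two r i j) ! length p)"
      have critical_sub: "critical \<subseteq> w ` ({..<k} \<times> {..<k})"
      proof
        fix x assume "x \<in> critical"
        then obtain r i j where r: "prefix (p @ [x]) r" "two r i j" by (auto simp: critical_def)
        have "(SOME r. two r i j) = r" using r(2) uniq by blast
        then have "x = w (i, j)" using r(1) by (auto simp: w_def prefix_def nth_append)
        moreover have "i < k" "j < k" using r(2) p(2) by (auto simp: two_def)
        ultimately show "x \<in> w ` ({..<k} \<times> {..<k})" by blast
      qed
      have critical: "finite critical" "card critical \<le> n" "critical \<subseteq> layer s"
        using finite_subset[OF critical_sub] surj_card_le[OF _ critical_sub] k_le A(1)
        by (simp_all add: card_cartesian_product) (auto simp: critical_def)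
      obtain c where c: "[\<theta> \<mapsto> c] \<in> P"
        using P_extend[OF P_empty _ _ \<theta>] by auto
      have c3: "c < 3" using P_less[OF c, of \<theta>] by simp
      have dT: "ty ` critical \<subseteq> dom [\<theta> \<mapsto> c]" using A(2) by (auto simp: critical_def)
      obtain f0 where f0: "\<And>v. f0 v < 3" "\<And>u v. u \<in> layer s \<Longrightarrow> v \<in> layer s \<Longrightarrow> Ep u v \<Longrightarrow> f0 u \<noteq> f0 v"
        "\<And>v. v \<in> critical \<Longrightarrow> [\<theta> \<mapsto> c] (ty v) = Some (f0 v)"
        using presc[OF critical(3,1,2) c dT] by metis
      \<comment> \<open>The game fixes a colour \<open>c\<close> for the type \<open>\<theta>\<close>; renaming the colours turns it into \<open>a\<close>.\<close>
      define f where "f v = transpose c a (f0 v)" for v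
      have f: "f v < 3" "u \<in> layer s \<Longrightarrow> v \<in> layer s \<Longrightarrow> Ep u v \<Longrightarrow> f u \<noteq> f v" for u v
        using f0(1)[of v] f0(2)[of u v] a(1) c3 by (auto simp: f_def transpose_def split: if_splits)
      have fT: "f v = a" if "v \<in> critical" for v
        using f0(3)[OF that] that A(2) by (auto simp: f_def critical_def)
      have "Inv (p @ [x]) (cs @ [f x])" if x: "x \<in> A" for x
        unfolding Inv_def
      proof (intro conjI impI)
        show "\<forall>i < length (p @ [x]). (cs @ [f x]) ! i = \<kappa>" if "alert (p @ [x])"
          using that alert_prefix False by blast
        show "\<exists>a < 3. \<forall>r \<psi>. prefix (p @ [x]) r \<longrightarrow>
            (\<exists>b. \<forall>i < length (p @ [x]). sees r \<psi> (p @ [x]) i \<longrightarrow> (cs @ [f x]) ! i \<in> {a, b})"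
        proof (cases "x \<in> critical")
          case True
          show ?thesis
          proof (rule exI[of _ a], intro conjI allI impI)
            fix r \<psi> assume "prefix (p @ [x]) r"
            then obtain b where b: "\<forall>i < length p. sees r \<psi> p i \<longrightarrow> cs ! i \<in> {a, b}"
              using a(2) append_prefixD by blast
            show "\<exists>b. \<forall>i < length (p @ [x]). sees r \<psi> (p @ [x]) i \<longrightarrow> (cs @ [f x]) ! i \<in> {a, b}"
              using b fT[OF True] p(3)
              by (intro exI[of _ b]) (auto simp: nth_append less_Suc_eq sees_snoc)
          qed (rule a(1))
        next
          case xT: False
          show ?thesis
          proof (rule exI[of _ "f x"], intro conjI allI impI)
            fix r \<psi> assume r: "prefix (p @ [x]) r"
            have one: "i = j" if "i < length p" "j < length p" "sees r \<psi> p i" "sees r \<psi> p j" for i j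
              using that r xT x unfolding critical_def two_def by (metis (mono_tags, lifting) mem_Collect_eq linorder_neqE_nat)
            have "\<exists>b. \<forall>i < length p. sees r \<psi> p i \<longrightarrow> cs ! i = b"
              using one by metis
            then show "\<exists>b. \<forall>i < length (p @ [x]). sees r \<psi> (p @ [x]) i \<longrightarrow> (cs @ [f x]) ! i \<in> {f x, b}"
              using p(3) by (elim ex_forward) (auto simp: nth_append less_Suc_eq sees_snoc)
          qed (rule f(1))
        qed
      qed
      then show ?thesis using f no_marked by (intro exI[of _ f]) (auto simp: Q_def Ep_def)
    qed
  qed
  have start: "Inv [] []" by (auto simp: Inv_def intro: exI[of _ 0])
  obtain col where Q: "\<And>p. set p \<subseteq> A \<Longrightarrow> length p < k \<Longrightarrow> Q p (col p)"
    and I: "\<And>p. set p \<subseteq> A \<Longrightarrow> length p \<le> k \<Longrightarrow> Inv p (map (\<lambda>i. col (take i p) (p ! i)) [0..<length p])"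
    using path_choice[of Inv A k Q, OF start step] by blast
  show ?thesis
  proof
    fix p v assume p: "set p \<subseteq> A" "length p < k"
    show "col p v < 3" using Q[OF p] by (simp add: Q_def)
    show "g (ty v) = Some (col p v)" if "Copy \<theta> p v \<in> S"
    proof -
      have "v \<in> marked p" using that by (force simp: marked_def alert_def)
      then have "h (ty v) = Some (col p v)" using Q[OF p] by (simp add: Q_def)
      moreover have "ty v \<in> ty ` S" using imageI[OF that, of ty] by simp
      ultimately show ?thesis using h(3) by simp
    qed
  next
    fix p u v assume "set p \<subseteq> A" "length p < k" "u \<in> layer s" "v \<in> layer s" "E (Copy \<theta> p u) (Copy \<theta> p v)"
    then show "col p u \<noteq> col p v" using Q[of p] by (auto simp: Q_def)
  next
    fix p \<psi> assume p: "set p \<subseteq> A" "length p = k" and R: "R \<theta> \<psi>"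
    have inv: "Inv p (map (\<lambda>i. col (take i p) (p ! i)) [0..<length p])"
      by (rule I[OF p(1)]) (simp add: p(2))
    show "\<exists>c < 3. (\<forall>i < k. E (Apex \<theta> p \<psi>) (Copy \<theta> (take i p) (p ! i)) \<longrightarrow> col (take i p) (p ! i) \<noteq> c) \<and>
         (Apex \<theta> p \<psi> \<in> S \<longrightarrow> g \<psi> = Some c)"
    proof (cases "Apex \<theta> p \<psi> \<in> S")
      case True
      then have "alert p" by (force simp: alert_def)
      then have mono: "\<forall>i < k. col (take i p) (p ! i) = \<kappa>" using inv p by (auto simp: Inv_def)
      have "\<psi> \<in> ty ` S" using imageI[OF True, of ty] by simp
      then obtain c where c: "g \<psi> = Some c" "h \<psi> = Some c" using g(2) h(3) by fastforce
      have "c < 3" "\<kappa> \<noteq> c" by (rule P_less[OF h(1) c(2)], rule P_proper[OF h(1) R h(2) c(2)])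
      then show ?thesis using c(1) mono by (intro exI[of _ c]) auto
    next
      case False
      obtain a where "\<forall>r \<psi>. prefix p r \<longrightarrow> (\<exists>b. \<forall>i < length p. sees r \<psi> p i \<longrightarrow>
          map (\<lambda>i. col (take i p) (p ! i)) [0..<length p] ! i \<in> {a, b})"
        using inv unfolding Inv_def by blast
      then obtain b where "\<forall>i < length p. sees p \<psi> p i \<longrightarrow>
          map (\<lambda>i. col (take i p) (p ! i)) [0..<length p] ! i \<in> {a, b}"
        using prefix_order.refl by blast
      then have ab: "\<forall>i < k. sees p \<psi> p i \<longrightarrow> col (take i p) (p ! i) \<in> {a, b}"
        using p(2) by simp
      have "\<not> {0, 1, 2} \<subseteq> {a, b}" by auto
      then obtain c where "c \<in> {0, 1, 2}" "c \<notin> {a, b}" by blast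
      then have "c < 3" by auto
      then show ?thesis using ab False \<open>c \<notin> {a, b}\<close> by (intro exI[of _ c]) (auto simp: sees_def)
    qed
  qed
qed

lemma prescribable: "prescribable s"
proof (induction s)
  case 0
  show ?case
    unfolding prescribable_def
  proof (intro allI impI, elim conjE)
    fix E :: "'f vert \<Rightarrow> 'f vert \<Rightarrow> bool" and S g
    assume E: "\<forall>u v. E u v \<longrightarrow> adj u v" and g: "g \<in> P" "ty ` S \<subseteq> dom g"
    define f where "f v = (case g (ty v) of Some c \<Rightarrow> c | None \<Rightarrow> 0)" for v
    show "\<exists>f. (\<forall>v. f v < 3) \<and> (\<forall>u \<in> layer 0. \<forall>v \<in> layer 0. E u v \<longrightarrow> f u \<noteq> f v) \<and>
          (\<forall>v \<in> S. g (ty v) = Some (f v))"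
      using E g by (intro exI[of _ f]) (force simp: f_def split: option.splits dest: P_less)
  qed
next
  case (Suc s)
  show ?case
    unfolding prescribable_def
  proof (intro allI impI, elim conjE)
    fix E :: "'f vert \<Rightarrow> 'f vert \<Rightarrow> bool" and S g
    assume a: "symp E" "no_C4 E" "\<forall>u v. E u v \<longrightarrow> adj u v" "S \<subseteq> layer (Suc s)" "finite S" "card S \<le> n"
      "g \<in> P" "ty ` S \<subseteq> dom g"
    define good where "good \<theta> col \<longleftrightarrow>
      (\<forall>p v. set p \<subseteq> of_type (layer s) \<theta> \<longrightarrow> length p < k \<longrightarrow> col p v < 3) \<and>
      (\<forall>p u v. set p \<subseteq> of_type (layer s) \<theta> \<longrightarrow> length p < k \<longrightarrow> u \<in> layer s \<longrightarrow> v \<in> layer s \<longrightarrow>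
         E (Copy \<theta> p u) (Copy \<theta> p v) \<longrightarrow> col p u \<noteq> col p v) \<and>
      (\<forall>p v. set p \<subseteq> of_type (layer s) \<theta> \<longrightarrow> length p < k \<longrightarrow> Copy \<theta> p v \<in> S \<longrightarrow> g (ty v) = Some (col p v)) \<and>
      (\<forall>p \<psi>. set p \<subseteq> of_type (layer s) \<theta> \<longrightarrow> length p = k \<longrightarrow> R \<theta> \<psi> \<longrightarrow>
         (\<exists>c < 3. (\<forall>i < k. E (Apex \<theta> p \<psi>) (Copy \<theta> (take i p) (p ! i)) \<longrightarrow> col (take i p) (p ! i) \<noteq> c) \<and>
           (Apex \<theta> p \<psi> \<in> S \<longrightarrow> g \<psi> = Some c)))"
      for \<theta> and col :: "'f vert list \<Rightarrow> 'f vert \<Rightarrow> nat"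
    have "\<exists>col. good \<theta> col" if \<theta>: "\<theta> \<in> F" for \<theta>
      by (rule tree_colouring[OF Suc a(1,2) _ a(4-8) \<theta>], use a(3) in blast)
        (unfold good_def, blast)
    then obtain col where col: "\<And>\<theta>. \<theta> \<in> F \<Longrightarrow> good \<theta> (col \<theta>)" by metis
    define apex_ok where "apex_ok \<theta> p \<psi> c \<longleftrightarrow> c < 3 \<and>
      (\<forall>i < k. E (Apex \<theta> p \<psi>) (Copy \<theta> (take i p) (p ! i)) \<longrightarrow> col \<theta> (take i p) (p ! i) \<noteq> c) \<and>
      (Apex \<theta> p \<psi> \<in> S \<longrightarrow> g \<psi> = Some c)" for \<theta> p \<psi> c
    define f where "f v = (if v \<in> layer (Suc s) then
       (case v of Base \<phi> \<Rightarrow> 0 | Copy \<theta> p v \<Rightarrow> col \<theta> p v | Apex \<theta> p \<psi> \<Rightarrow> (SOME c. apex_ok \<theta> p \<psi> c)) else 0)"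
      for v
    have f_copy: "f (Copy \<theta> p v) = col \<theta> p v" if "Copy \<theta> p v \<in> layer (Suc s)" for \<theta> p v
      using that by (simp add: f_def)
    have f_apex: "apex_ok \<theta> p \<psi> (f (Apex \<theta> p \<psi>))" if "Apex \<theta> p \<psi> \<in> layer (Suc s)" for \<theta> p \<psi>
    proof -
      have "\<exists>c. apex_ok \<theta> p \<psi> c" using that col[of \<theta>] by (auto simp: good_def apex_ok_def)
      then have "apex_ok \<theta> p \<psi> (SOME c. apex_ok \<theta> p \<psi> c)" by (rule someI_ex)
      then show ?thesis using that by (simp add: f_def)
    qed
    have less: "f v < 3" for v
    proof (cases "v \<in> layer (Suc s)")
      case True
      then show ?thesis
        using col f_copy f_apex by (cases v) (auto simp: good_def apex_ok_def)
    qed (auto simp: f_def)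
    have apex_copy: "f u \<noteq> f v"
      if uv: "u \<in> layer (Suc s)" "v \<in> layer (Suc s)" "E u v" "u = Apex \<theta> p \<psi>" "v = Copy \<theta>' q w"
      for u v \<theta> p \<psi> \<theta>' q w
    proof -
      have "adj u v" using a(3) uv by blast
      then obtain i where i: "\<theta>' = \<theta>" "i < length p" "q = take i p" "w = p ! i" using uv by auto
      have "length p = k" using uv by auto
      then show ?thesis using f_apex[of \<theta> p \<psi>] f_copy[of \<theta>' q w] uv i by (auto simp: apex_ok_def)
    qed
    have proper: "f u \<noteq> f v" if uv: "u \<in> layer (Suc s)" "v \<in> layer (Suc s)" "E u v" for u v
    proof -
      have ad: "adj u v" and E': "E v u" using a(1,3) uv by (auto simp: symp_def)
      show ?thesis
      proof (cases u)
        case (Base x)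
        then show ?thesis using ad by simp
      next
        case u: (Copy \<theta> p u')
        show ?thesis
        proof (cases v)
          case v: (Copy \<theta>' q v')
          then have eq: "\<theta>' = \<theta>" "q = p" using ad u by auto
          show ?thesis
            using col[of \<theta>] uv f_copy unfolding u v eq by (auto simp: good_def)
        next
          case (Apex \<theta>' q \<psi>)
          then show ?thesis using apex_copy[OF uv(2,1) E' Apex u] by simp
        qed (use ad u in auto)
      next
        case u: (Apex \<theta> p \<psi>)
        show ?thesis
        proof (cases v)
          case (Copy \<theta>' q v')
          then show ?thesis using apex_copy[OF uv u Copy] by simp
        qed (use ad u in auto)
      qed
    qed
    have presc: "g (ty v) = Some (f v)" if "v \<in> S" for v
    proof -
      have v: "v \<in> layer (Suc s)" using that a(4) by blast
      then show ?thesis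
        using that col f_copy f_apex by (cases v) (auto simp: good_def apex_ok_def)
    qed
    show "\<exists>f. (\<forall>v. f v < 3) \<and> (\<forall>u \<in> layer (Suc s). \<forall>v \<in> layer (Suc s). E u v \<longrightarrow> f u \<noteq> f v) \<and>
          (\<forall>v \<in> S. g (ty v) = Some (f v))"
      using less proper presc by blast
  qed
qed

end

section \<open>The pebble game on a shift graph\<close>

text \<open>
  The strategy for the shift graph: the points that occur in the pebbled vertices carry distinct
  labels, and a vertex is coloured by looking at the labels of its entries alone. Labels are dropped
  when their points leave the board, so a bounded supply of labels lasts forever.
\<close>

definition labelled_colourings :: "nat \<Rightarrow> nat list set \<Rightarrow> (nat list \<rightharpoonup> nat) set" where
  "labelled_colourings q F = {g. dom g \<subseteq> F \<and> (\<exists>l. inj_on l (\<Union> (set ` dom g)) \<and>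
     l ` (\<Union> (set ` dom g)) \<subseteq> {..<q} \<times> {..<q} \<and> (\<forall>xs \<in> dom g. g xs = Some (list_colour q (map l xs))))}"

lemma labelled_colouringsE:
  assumes "g \<in> labelled_colourings q F"
  obtains l where "inj_on l (\<Union> (set ` dom g))" "l ` (\<Union> (set ` dom g)) \<subseteq> {..<q} \<times> {..<q}"
    "\<forall>xs \<in> dom g. g xs = Some (list_colour q (map l xs))" "dom g \<subseteq> F"
  using assms unfolding labelled_colourings_def mem_Collect_eq
  by (elim conjE exE) (rule that; assumption)

lemma extend_injection:
  assumes "finite X" "finite Y" "inj_on l X" "l ` X \<subseteq> L" "finite L" "card X + card Y \<le> card L"
  obtains l' where "inj_on l' (X \<union> Y)" "l' ` (X \<union> Y) \<subseteq> L" "\<And>x. x \<in> X \<Longrightarrow> l' x = l x"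
proof -
  have "card (Y - X) \<le> card Y" using assms(2) by (simp add: card_mono)
  also have "\<dots> \<le> card L - card (l ` X)" using assms(3,6) by (simp add: card_image)
  also have "\<dots> = card (L - l ` X)" using assms by (simp add: card_Diff_subset)
  finally obtain m where m: "m ` (Y - X) \<subseteq> L - l ` X" "inj_on m (Y - X)"
    using card_le_inj[of "Y - X" "L - l ` X"] assms(2,5) by auto
  define l' where "l' x = (if x \<in> X then l x else m x)" for x
  have "inj_on l' (X \<union> (Y - X))"
    unfolding inj_on_Un using assms(3) m by (auto simp: l'_def inj_on_def)
  then show ?thesis
    using that[of l'] assms(4) m by (auto simp: l'_def)
qed

text \<open>
  Two adjacent vertices of the shift graph are the two windows of a sequence of distinct points, so
  \<open>list_colour_shift\<close> makes these colourings proper. With \<open>n\<close> pebbles on the board and one more to be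
  placed, at most \<open>(n + 1) * (4 * q + 4)\<close> points carry labels.
\<close>

lemma pebble_layers_shift:
  assumes F: "F = shift_types (4 * q + 4) N" and nq: "(n + 1) * (4 * q + 4) \<le> q * q" "k * k \<le> n"
  shows "pebble_layers F shift_adj k (labelled_colourings q F) n"
proof
  let ?P = "labelled_colourings q F"
  have len: "length xs = 4 * q + 4" "distinct xs" if "xs \<in> F" for xs
    using that strict_sorted_iff by (auto simp: F shift_types_def)
  show "finite F" by (simp add: F finite_shift_types)
  show "shift_adj \<phi> \<psi> \<longleftrightarrow> shift_adj \<psi> \<phi>" for \<phi> \<psi> by (rule shift_adj_sym)
  show "a < 3" if "g \<in> ?P" "g \<phi> = Some a" for g \<phi> a
    using that list_colour_less by (force simp: labelled_colourings_def)
  show "Map.empty \<in> ?P" by (auto simp: labelled_colourings_def)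
  show "g |` A \<in> ?P" if g: "g \<in> ?P" for g A
  proof -
    have sub: "\<Union> (set ` dom (g |` A)) \<subseteq> \<Union> (set ` dom g)" by auto
    obtain l where l: "inj_on l (\<Union> (set ` dom g))" "l ` (\<Union> (set ` dom g)) \<subseteq> {..<q} \<times> {..<q}"
      "\<forall>xs \<in> dom g. g xs = Some (list_colour q (map l xs))" "dom g \<subseteq> F"
      by (rule labelled_colouringsE[OF g])
    have "l ` (\<Union> (set ` dom (g |` A))) \<subseteq> {..<q} \<times> {..<q}"
      using image_mono[OF sub] l(2) by (rule subset_trans)
    then show ?thesis
      unfolding labelled_colourings_def
      using l(3,4) inj_on_subset[OF l(1) sub] by (intro CollectI conjI exI[of _ l]) auto
  qed
  show "k * k \<le> n" by fact
  have one: "a \<noteq> b" if gP: "g \<in> ?P" and "tl \<phi> = butlast \<psi>" "g \<phi> = Some a" "g \<psi> = Some b" for g \<phi> \<psi> a b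
  proof -
    obtain l where l: "inj_on l (\<Union> (set ` dom g))" "l ` (\<Union> (set ` dom g)) \<subseteq> {..<q} \<times> {..<q}"
      "\<forall>xs \<in> dom g. g xs = Some (list_colour q (map l xs))" and dom: "dom g \<subseteq> F"
      by (rule labelled_colouringsE[OF gP])
    have d: "\<phi> \<in> dom g" "\<psi> \<in> dom g" using that(3,4) by auto
    then have in_F: "\<phi> \<in> F" "\<psi> \<in> F" using dom by auto
    \<comment> \<open>The increasing sequence whose two windows are \<open>\<phi>\<close> and \<open>\<psi>\<close>.\<close>
    define zs where "zs = hd \<phi> # \<psi>"
    have \<phi>: "\<phi> = hd \<phi> # tl \<phi>" "\<phi> \<noteq> []" using len(1)[OF in_F(1)] by (cases \<phi>; simp)+
    have \<psi>: "\<psi> \<noteq> []" using len(1)[OF in_F(2)] by auto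
    have zs: "butlast zs = \<phi>" "tl zs = \<psi>" "length zs = Suc (4 * q + 4)"
      using \<phi> \<psi> that(2) len(1)[OF in_F(2)] by (auto simp: zs_def)
    have "hd \<phi> < hd \<psi>"
      using shift_types_step(2)[OF _ _ that(2)] in_F by (simp add: F)
    moreover have "hd \<psi> \<le> x" if "x \<in> set \<psi>" for x
      using that in_F(2) \<psi> by (cases \<psi>) (auto simp: F shift_types_def)
    ultimately have "hd \<phi> \<notin> set \<psi>" using not_le by blast
    then have "distinct zs" using len(2)[OF in_F(2)] by (simp add: zs_def)
    moreover have sub: "set zs \<subseteq> \<Union> (set ` dom g)" using d hd_in_set[OF \<phi>(2)] by (auto simp: zs_def simp del: hd_in_set)
    ultimately have "list_colour q (butlast (map l zs)) \<noteq> list_colour q (tl (map l zs))"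
      using inj_on_subset[OF l(1) sub] subset_trans[OF image_mono[OF sub] l(2)] zs(3)
      by (intro list_colour_shift) (simp_all add: distinct_map)
    then show ?thesis
      using bspec[OF l(3) d(1)] bspec[OF l(3) d(2)] that(3,4) zs by (simp add: map_butlast[symmetric] map_tl[symmetric])
  qed
  show "a \<noteq> b" if "g \<in> ?P" "shift_adj \<phi> \<psi>" "g \<phi> = Some a" "g \<psi> = Some b" for g \<phi> \<psi> a b
    using that one[of g \<phi> \<psi> a b] one[of g \<psi> \<phi> b a] by (auto simp: shift_adj_def)
  show "\<exists>c. g(\<theta> \<mapsto> c) \<in> ?P"
    if g: "g \<in> ?P" "finite (dom g)" "card (dom g) \<le> n" "\<theta> \<in> F" "\<theta> \<notin> dom g" for g \<theta>
  proof -
    let ?X = "\<Union> (set ` dom g)"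
    obtain l where l: "inj_on l ?X" "l ` ?X \<subseteq> {..<q} \<times> {..<q}"
      "\<forall>xs \<in> dom g. g xs = Some (list_colour q (map l xs))" and dom: "dom g \<subseteq> F"
      by (rule labelled_colouringsE[OF g(1)])
    have "card ?X \<le> (\<Sum>xs\<in>dom g. card (set xs))" by (rule card_UN_le[OF g(2)])
    also have "\<dots> \<le> card (dom g) * (4 * q + 4)"
      using dom len(1) by (intro sum_bounded_above[of _ _ "4 * q + 4", simplified]) (metis card_length subsetD)
    also have "\<dots> \<le> n * (4 * q + 4)" using g(3) by (rule mult_le_mono1)
    finally have "card ?X + card (set \<theta>) \<le> card ({..<q} \<times> {..<q})"
      using nq(1) card_length[of \<theta>] len(1)[OF g(4)] by (simp add: card_cartesian_product)
    then obtain l' where l': "inj_on l' (?X \<union> set \<theta>)" "l' ` (?X \<union> set \<theta>) \<subseteq> {..<q} \<times> {..<q}"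
      "\<And>x. x \<in> ?X \<Longrightarrow> l' x = l x"
      using extend_injection[OF _ _ l(1,2), of "set \<theta>"] g(2) by (metis List.finite_set finite_SigmaI finite_UN finite_lessThan)
    have "map l' xs = map l xs" if "xs \<in> dom g" for xs using that l'(3) by auto
    then have "\<forall>xs \<in> dom g. g xs = Some (list_colour q (map l' xs))" using l(3) by metis
    moreover have "\<Union> (set ` dom (g(\<theta> \<mapsto> c))) = ?X \<union> set \<theta>" for c by auto
    ultimately have "g(\<theta> \<mapsto> list_colour q (map l' \<theta>)) \<in> ?P"
      using l'(1,2) dom g(4,5) unfolding labelled_colourings_def
      by (intro CollectI conjI exI[of _ l']) simp_all
    then show ?thesis by blast
  qed
qed

section \<open>The graph\<close>

lemma pair_graph_imp_wf: "pair_graph G \<Longrightarrow> pair_wf_digraph G"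
proof -
  assume "pair_graph G"
  then interpret pair_graph G .
  show ?thesis by unfold_locales
qed

lemma triangle_freeI:
  assumes "pair_wf_digraph G"
    and "\<And>x y z. (x, y) \<in> parcs G \<Longrightarrow> (y, z) \<in> parcs G \<Longrightarrow> (x, z) \<in> parcs G \<Longrightarrow> False"
  shows "triangle_free G"
proof -
  have wf: "pair_wf_digraph (cycle_graph 3)"
    by (intro pair_graph_imp_wf pair_graph_cycle_graph) simp
  have arcs: "(0, 1) \<in> parcs (cycle_graph 3)" "(1, 2) \<in> parcs (cycle_graph 3)"
    "(0, 2) \<in> parcs (cycle_graph 3)" by (simp_all add: cycle_graph_def)
  show ?thesis
    unfolding triangle_free_def subgraph_free_iff_no_embedding[OF wf assms(1)]
  proof (rule notI, elim exE conjE)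
    fix f assume "\<forall>(u, v) \<in> parcs (cycle_graph 3). (f u, f v) \<in> parcs G"
    with arcs have "(f 0, f 1) \<in> parcs G" "(f 1, f 2) \<in> parcs G" "(f 0, f 2) \<in> parcs G" by auto
    then show False by (rule assms(2))
  qed
qed

lemma C4_free_imp_no_C4:
  assumes H: "pair_graph H" and "C4_free H"
  shows "no_C4 (\<lambda>u v. (u, v) \<in> parcs H)"
  unfolding no_C4_def
proof (intro allI impI, rule ccontr)
  interpret H: pair_graph H by fact
  fix a b u v
  assume h: "u \<noteq> v" "(a, u) \<in> parcs H" "(a, v) \<in> parcs H" "(b, u) \<in> parcs H" "(b, v) \<in> parcs H"
    and "a \<noteq> b"
  have sym: "(y, x) \<in> parcs H" if "(x, y) \<in> parcs H" for x y
    using that H.sym_arcs by (auto simp: symmetric_def sym_def)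
  have ne: "x \<noteq> y" if "(x, y) \<in> parcs H" for x y
    using H.pair_no_loops[OF that] by simp
  define f where "f = (!) [a, u, b, v]"
  have verts: "pverts (cycle_graph 4) = {0, 1, 2, 3}" by (auto simp: cycle_graph_def)
  have wf: "pair_wf_digraph (cycle_graph 4)"
    by (intro pair_graph_imp_wf pair_graph_cycle_graph) simp
  have "distinct [a, u, b, v]" using h \<open>a \<noteq> b\<close> ne by auto
  then have "inj_on f (pverts (cycle_graph 4))"
    unfolding f_def by (rule inj_on_nth) (simp add: verts)
  moreover have "f ` pverts (cycle_graph 4) \<subseteq> pverts H"
    using H.in_arcsD1 H.in_arcsD2 h by (auto simp: verts f_def)
  moreover have "\<forall>(i, j) \<in> parcs (cycle_graph 4). (f i, f j) \<in> parcs H"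
  proof (clarify)
    fix i j assume "(i, j) \<in> parcs (cycle_graph 4)"
    then have "i \<in> {0, 1, 2, 3}" "j \<in> {0, 1, 2, 3}" "j = Suc i mod 4 \<or> i = Suc j mod 4"
      by (auto simp: cycle_graph_def)
    then show "(f i, f j) \<in> parcs H" using h(2-5) h(2-5)[THEN sym] by (auto simp: f_def)
  qed
  ultimately show False
    using \<open>C4_free H\<close> subgraph_free_iff_no_embedding[OF wf pair_graph_imp_wf[OF H]]
    unfolding C4_free_def by blast
qed

theorem theorem1p3:
  fixes k :: nat
  assumes "k \<ge> 1"
  shows "\<exists>G :: nat pair_pre_digraph.
    pair_graph G \<and> triangle_free G \<and> chromatic_number G > k \<and>
    (\<forall>H :: nat pair_pre_digraph.
       pair_graph H \<and> subgraph (with_proj H) (with_proj G) \<and> C4_free H \<longrightarrow> colourable 3 H)"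
proof -
  define n where "n = k * k"
  \<comment> \<open>This makes the \<open>q\<^sup>2\<close> labels enough for \<open>n + 1\<close> tuples of length \<open>4 * q + 4\<close>.\<close>
  define q where "q = 8 * (n + 1)"
  obtain N where N: "\<And>h. h ` shift_types (4 * q + 4) N \<subseteq> Pow {..<k} \<Longrightarrow>
      \<exists>x \<in> shift_types (4 * q + 4) N. \<exists>y \<in> shift_types (4 * q + 4) N. shift_adj x y \<and> h x = h y"
    using shift_types_uncolourable[of "Pow {..<k}" "4 * q + 4"] by auto
  define F where "F = shift_types (4 * q + 4) N"
  have q: "(n + 1) * (4 * q + 4) \<le> q * q"
  proof -
    have "(n + 1) * (4 * q + 4) \<le> (n + 1) * (8 * q)"
      by (rule mult_le_mono2) (simp add: q_def)
    also have "\<dots> = q * q" by (simp add: q_def algebra_simps)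
    finally show ?thesis .
  qed
  interpret L: pebble_layers F shift_adj k "labelled_colourings q F" n
    by (rule pebble_layers_shift[OF F_def q]) (simp add: n_def)
  \<comment> \<open>More than the total number of colours that \<open>k\<close> colours can show on the types.\<close>
  define s where "s = Suc (card F * k)"
  define W where "W = L.layer s"
  have "finite W" by (simp add: W_def L.finite_layer)
  from finite_imp_inj_to_nat_seg[OF this] obtain e :: "nat list vert \<Rightarrow> nat" where e: "inj_on e W"
    by (elim exE conjE)
  define A where "A = {(e u, e v) | u v. u \<in> W \<and> v \<in> W \<and> adj u v}"
  define G where "G = \<lparr> pverts = e ` W, parcs = A \<rparr>"
  have A_iff: "(e u, e v) \<in> A \<longleftrightarrow> adj u v" if "u \<in> W" "v \<in> W" for u v
    using that by (auto simp: A_def inj_on_eq_iff[OF e])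
  have types: "shift_adj (ty u) (ty v)" if "u \<in> W" "v \<in> W" "adj u v" for u v
    using that L.adj_types by (auto simp: W_def)
  have irrefl: "\<not> adj u u" for u :: "nat list vert" by (induction u) auto
  interpret G: pair_graph G
  proof
    show "finite (pverts G)" using \<open>finite W\<close> by (simp add: G_def)
    have "parcs G \<subseteq> e ` W \<times> e ` W" by (auto simp: G_def A_def)
    then show "finite (parcs G)" by (rule finite_subset) (simp add: \<open>finite W\<close>)
    show "fst a \<in> pverts G" "snd a \<in> pverts G" if "a \<in> parcs G" for a
      using that by (auto simp: G_def A_def)
    show "fst a \<noteq> snd a" if "a \<in> parcs G" for a
      using that irrefl by (auto simp: G_def A_def inj_on_eq_iff[OF e])
    show "symmetric (with_proj G)"
      using adj_sym by (auto simp: G_def A_def symmetric_def sym_def)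
  qed
  have "triangle_free G"
  proof (rule triangle_freeI)
    show "pair_wf_digraph G" by unfold_locales
    fix x y z assume "(x, y) \<in> parcs G" "(y, z) \<in> parcs G" "(x, z) \<in> parcs G"
    then obtain a b c where abc: "a \<in> W" "b \<in> W" "c \<in> W" "adj a b" "adj b c" "adj a c"
      by (auto simp: G_def A_def inj_on_eq_iff[OF e])
    then have "ty a \<in> F" "ty b \<in> F" "ty c \<in> F" using L.ty_layer unfolding W_def by blast+
    with types abc show False
      unfolding F_def by (intro shift_triangle_free[of "ty a" _ _ "ty b" "ty c"]) auto
  qed
  moreover have "\<not> colourable k G"
  proof
    assume "colourable k G"
    then obtain c where c: "\<forall>v \<in> pverts G. c v < k" "\<forall>(u, v) \<in> parcs G. c u \<noteq> c v"
      by (auto simp: colourable_def)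
    have c1: "c (e v) < k" if "v \<in> W" for v using c(1) that by (simp add: G_def)
    have c2: "c (e u) \<noteq> c (e v)" if "u \<in> W" "v \<in> W" "adj u v" for u v
      using c(2) that by (auto simp: G_def A_def)
    have "s \<le> (\<Sum>\<phi>\<in>F. card (L.palette (c \<circ> e) s \<phi>))"
      using L.palette_sum[OF assms, of s "c \<circ> e"] N c1 c2 by (auto simp: F_def W_def)
    also have "\<dots> \<le> (\<Sum>\<phi>\<in>F. k)"
    proof (rule sum_mono)
      fix \<phi>
      have "L.palette (c \<circ> e) s \<phi> \<subseteq> {..<k}"
        using c1 by (auto simp: L.palette_def of_type_def W_def)
      from card_mono[OF _ this] show "card (L.palette (c \<circ> e) s \<phi>) \<le> k" by simp
    qed
    finally show False by (simp add: s_def)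
  qed
  moreover have "colourable 3 H"
    if H: "pair_graph H" "subgraph (with_proj H) (with_proj G)" "C4_free H" for H :: "nat pair_pre_digraph"
  proof -
    interpret H: pair_graph H by fact
    have sub: "pverts H \<subseteq> e ` W" "parcs H \<subseteq> A"
      using H(2) by (auto simp: subgraph_def G_def)
    define E where "E u v \<longleftrightarrow> u \<in> W \<and> v \<in> W \<and> (e u, e v) \<in> parcs H" for u v
    have sym: "(v, u) \<in> parcs H" if "(u, v) \<in> parcs H" for u v
      using that H.sym_arcs by (auto simp: symmetric_def sym_def)
    have E_adj: "adj u v" if "E u v" for u v
      using that sub(2) A_iff by (auto simp: E_def)
    have "no_C4 E"
      using C4_free_imp_no_C4[OF H(1,3)] inj_onD[OF e] unfolding no_C4_def E_def by metis
    moreover have "symp E" using sym by (auto simp: E_def symp_def)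
    ultimately obtain f :: "nat list vert \<Rightarrow> nat"
      where f: "\<And>v. f v < 3" "\<And>u v. u \<in> W \<Longrightarrow> v \<in> W \<Longrightarrow> E u v \<Longrightarrow> f u \<noteq> f v"
      using L.prescribableD[OF L.prescribable[of s], of E "{}" Map.empty] E_adj L.P_empty
      unfolding W_def by auto
    show ?thesis
      unfolding colourable_def
    proof (intro exI[of _ "\<lambda>x. f (inv_into W e x)"] conjI ballI)
      show "f (inv_into W e x) < 3" for x by (rule f(1))
      fix a assume "a \<in> parcs H"
      moreover from this obtain u v where "u \<in> W" "v \<in> W" "a = (e u, e v)"
        using sub(2) by (auto simp: A_def)
      ultimately show "case a of (u, v) \<Rightarrow> f (inv_into W e u) \<noteq> f (inv_into W e v)"
        using f(2)[of u v] by (simp add: E_def inv_into_f_f[OF e])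
    qed
  qed
  ultimately show ?thesis
    using G.pair_graph_axioms G.chromatic_number_gt_iff by blast
qed

end
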